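(* For each integer $n\geq 4$, there exist a Jordan domain $D_n\subset\mathbb{C}$ and a function $f_n$, analytic on an open neighborhood of the closure of $D_n$, such that $\operatorname{N}(f_n,D_n)=2$, but $f_n$ cannot be conformally modeled on $D_n$ by a polynomial of degree less than $n$; that is, whenever $p$ is a polynomial and $\phi:D_n\to\mathbb{C}$ is an injective holomorphic function with $f_n=p\circ\phi$ on $D_n$, one has $\deg(p)\geq n$.
   Context: $\widehat{\mathbb{C}}$ denotes the Riemann sphere. A Jordan domain is the bounded component of the complement in $\mathbb{C}$ of a Jordan curve. Degree of non-injectivity: for a set $E\subset\widehat{\mathbb{C}}$ and a function $f:E\to\widehat{\mathbb{C}}$, define $\operatorname{N}(f,E):=\sup_{w\in\widehat{\mathbb{C}}} n(w)$, where $n(w)$ is the number of preimages of $w$ under $f$ in $E$, counted with multiplicity. Conformal model: a polynomial $p$ is a conformal model for $f$ on $D$ if there is an injective holomorphic function $\phi:D\to\mathbb{C}$ such that $f=p\circ\phi$ on $D$. *)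

theory Defs
  imports "HOL-Complex_Analysis.Complex_Analysis" "HOL-Library.Extended_Nat"
begin

definition jordan_curve :: "complex set \<Rightarrow> bool" where
  "jordan_curve J \<longleftrightarrow>
     (\<exists>\<gamma>. simple_path \<gamma> \<and> pathfinish \<gamma> = pathstart \<gamma> \<and> path_image \<gamma> = J)"

definition jordan_domain :: "complex set \<Rightarrow> bool" where
  "jordan_domain D \<longleftrightarrow> (\<exists>J. jordan_curve J \<and> D \<in> components (- J) \<and> bounded D)"

(* Multiplicity of z as a preimage of f z, for f analytic at z. The first case is needed because
   zorder is unspecified for a function vanishing near z; there the multiplicity is infinite. *)
definition multiplicity_at :: "(complex \<Rightarrow> complex) \<Rightarrow> complex \<Rightarrow> enat" where
  "multiplicity_at f z =
     (if \<forall>\<^sub>F u in nhds z. f u = f z then \<infinity>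
      else enat (nat (zorder (\<lambda>u. f u - f z) z)))"

definition preimage_count :: "(complex \<Rightarrow> complex) \<Rightarrow> complex set \<Rightarrow> complex \<Rightarrow> enat" where
  "preimage_count f E w =
     (if finite {z \<in> E. f z = w} then (\<Sum>z \<in> {z \<in> E. f z = w}. multiplicity_at f z) else \<infinity>)"

(* The degree of non-injectivity N(f,E), for f complex-valued and analytic on a neighbourhood
   of E. The point at infinity of the Riemann sphere has no preimage under such an f, so it
   contributes 0 to the supremum and w need only range over the complex plane. *)
definition noninjectivity_degree :: "(complex \<Rightarrow> complex) \<Rightarrow> complex set \<Rightarrow> enat" where
  "noninjectivity_degree f E = (SUP w. preimage_count f E w)"

definition conformal_model ::
    "complex poly \<Rightarrow> (complex \<Rightarrow> complex) \<Rightarrow> complex set \<Rightarrow> bool" where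
  "conformal_model p f D \<longleftrightarrow>
     (\<exists>\<phi>. \<phi> holomorphic_on D \<and> inj_on \<phi> D \<and> (\<forall>z\<in>D. f z = poly p (\<phi> z)))"

end

theory Submission imports Defs begin

text \<open>
  A conformal map has no critical points, so if \<open>f = p \<circ> \<phi>\<close> on \<open>D\<close> with \<open>\<phi>\<close> injective, then \<open>\<phi>\<close>
  sends the critical points of \<open>f\<close> in \<open>D\<close> to distinct critical points of \<open>p\<close>, and \<open>p\<close> has degree
  larger than their number (\<open>degree_gt_card_critical_points\<close>). It therefore suffices to find a
  function that has many critical points in a Jordan domain and is nevertheless at most two-valent
  there. The function \<open>f z = z + exp z\<close> does this: its critical points
  \<open>(2 * k + 1) * pi * \<i>\<close> lie on the imaginary axis, \<open>f\<close> is injective to the left of that axis because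
  \<open>Re (f' z) > 0\<close> there, and the image of a vertical line slightly to the right of the axis is a
  trochoid with one small loop for each critical value, so that the loops are disjoint. The domain
  is a tall rectangle that reaches only a little beyond the axis, namely to \<open>Re z < ln (3/2)\<close>.

  The bound on the valence combines a global and a local estimate. Globally, \<open>f x = f y\<close> means
  \<open>x - y = exp y - exp x\<close>, which has modulus less than \<open>3/2 + 3/2 < pi\<close>, so all preimages of
  a point lie in one horizontal strip of height less than \<open>pi\<close>
  (\<open>Im_close_if_id_plus_exp_eq\<close>). Locally, \<open>f'' = exp\<close> maps such a strip, which is convex, into an
  open half-plane. The second divided difference of \<open>f\<close> is an average of values of \<open>f''\<close> over a
  triangle, hence nonzero, whereas it would vanish if a value were taken three times, counted with
  multiplicity (\<open>no_three_equal_values\<close> and \<open>critical_point_not_revisited\<close>).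
\<close>

section \<open>Valence at most two from a second derivative in a half-plane\<close>

lemma Re_less_Re_if_deriv_pos:
  fixes h h' :: "real \<Rightarrow> complex"
  assumes deriv: "\<And>t. t \<in> {0..1} \<Longrightarrow> (h has_vector_derivative h' t) (at t)"
    and pos: "\<And>t. t \<in> {0<..<1} \<Longrightarrow> Re (h' t) > 0"
  shows "Re (h 0) < Re (h 1)"
proof (rule DERIV_pos_imp_increasing_open[where f = "\<lambda>t. Re (h t)"])
  have Re_deriv: "((\<lambda>t. Re (h t)) has_real_derivative Re (h' t)) (at t)" if "t \<in> {0..1}" for t
    using deriv[OF that]
    by (simp add: has_vector_derivative_complex_iff has_real_derivative_iff_has_vector_derivative)
  show "\<exists>y. ((\<lambda>t. Re (h t)) has_real_derivative y) (at t) \<and> y > 0" if "0 < t" "t < 1" for t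
    using Re_deriv[of t] pos[of t] that by auto
  show "continuous_on {0..1} (\<lambda>t. Re (h t))"
    using Re_deriv by (meson DERIV_isCont continuous_at_imp_continuous_on)
qed simp

lemma has_vector_derivative_along_segment:
  fixes f :: "complex \<Rightarrow> complex"
  assumes "(f has_field_derivative f') (at (z + of_real t * a))"
  shows "((\<lambda>t. f (z + of_real t * a)) has_vector_derivative a * f') (at t)"
proof -
  have "((\<lambda>t. z + of_real t * a) has_vector_derivative a) (at t)"
    by (auto intro!: derivative_eq_intros simp: has_vector_derivative_def scaleR_conv_of_real)
  from field_vector_diff_chain_at[OF this assms] show ?thesis
    by (simp add: o_def)
qed

text \<open>
  The difference quotient is the average of \<open>g'\<close> over a segment. This is the argument behind the
  Noshiro--Warschawski criterion; the proofs below apply it to the derivative of a function.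
\<close>
lemma Re_difference_quotient_pos:
  fixes g :: "complex \<Rightarrow> complex"
  assumes "convex S" and pq: "p \<in> S" "q \<in> S" "p \<noteq> q"
    and g: "\<And>z. z \<in> S \<Longrightarrow> (g has_field_derivative g' z) (at z)"
    and pos: "\<And>z. z \<in> S \<Longrightarrow> Re (c * g' z) > 0"
  shows "Re (c * ((g p - g q) / (p - q))) > 0"
proof -
  have seg: "q + of_real t * (p - q) \<in> S" if "t \<in> {0..1}" for t
  proof -
    have "(1 - t) *\<^sub>R q + t *\<^sub>R p \<in> S"
      using assms that by (intro convexD) auto
    then show ?thesis by (simp add: scaleR_conv_of_real algebra_simps)
  qed
  have "Re (c / (p - q) * g (q + of_real 0 * (p - q)))
      < Re (c / (p - q) * g (q + of_real 1 * (p - q)))"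
  proof (rule Re_less_Re_if_deriv_pos)
    show "((\<lambda>t. c / (p - q) * g (q + of_real t * (p - q)))
        has_vector_derivative c / (p - q) * ((p - q) * g' (q + of_real t * (p - q)))) (at t)"
      if "t \<in> {0..1}" for t
      by (intro has_vector_derivative_mult_right has_vector_derivative_along_segment g seg that)
    show "Re (c / (p - q) * ((p - q) * g' (q + of_real t * (p - q)))) > 0"
      if "t \<in> {0<..<1}" for t
      using pos[OF seg[of t]] that pq by simp
  qed
  then show ?thesis
    by (simp add: diff_divide_distrib algebra_simps)
qed

text \<open>
  With \<open>a = x - z\<close> and \<open>b = y - z\<close>, the second divided difference of \<open>f\<close> at \<open>z, x, y\<close> is the total
  increment over \<open>[0, 1]\<close> of \<open>(f (z + t a) / a - f (z + t b) / b) / (a - b)\<close>, whose derivative at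
  \<open>t\<close> is \<open>t\<close> times a difference quotient of \<open>f'\<close>. After multiplication by \<open>c\<close> the real part thus
  increases strictly, so the three values cannot coincide.
\<close>
lemma no_three_equal_values:
  fixes f :: "complex \<Rightarrow> complex"
  assumes "convex S" and S: "z \<in> S" "x \<in> S" "y \<in> S"
    and dist: "x \<noteq> z" "y \<noteq> z" "x \<noteq> y"
    and f: "\<And>z. z \<in> S \<Longrightarrow> (f has_field_derivative f' z) (at z)"
    and f': "\<And>z. z \<in> S \<Longrightarrow> (f' has_field_derivative f'' z) (at z)"
    and pos: "\<And>z. z \<in> S \<Longrightarrow> Re (c * f'' z) > 0"
  shows "\<not> (f x = f z \<and> f y = f z)"
proof
  assume eq: "f x = f z \<and> f y = f z"
  define a b where "a = x - z" and "b = y - z"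
  have nz: "a \<noteq> 0" "b \<noteq> 0" "a - b \<noteq> 0"
    using dist by (auto simp: a_def b_def)
  have seg: "z + of_real t * (u - z) \<in> S" if "t \<in> {0..1}" "u \<in> S" for t u
  proof -
    have "(1 - t) *\<^sub>R z + t *\<^sub>R u \<in> S"
      using assms that by (intro convexD) auto
    then show ?thesis by (simp add: scaleR_conv_of_real algebra_simps)
  qed
  define h where "h t = c / (a - b) * (1 / a * f (z + of_real t * a) - 1 / b * f (z + of_real t * b))"
    for t
  define h' where "h' t = c / (a - b) *
     (1 / a * (a * f' (z + of_real t * a)) - 1 / b * (b * f' (z + of_real t * b)))" for t
  have "Re (h 0) < Re (h 1)"
  proof (rule Re_less_Re_if_deriv_pos[where h' = h'])
    fix t :: real assume "t \<in> {0..1}"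
    then show "(h has_vector_derivative h' t) (at t)"
      unfolding h_def h'_def
      by (intro has_vector_derivative_mult_right has_vector_derivative_diff
          has_vector_derivative_along_segment f) (auto simp: a_def b_def seg S)
  next
    fix t :: real assume t: "t \<in> {0<..<1}"
    let ?p = "z + of_real t * a" and ?q = "z + of_real t * b"
    have pq: "?p \<in> S" "?q \<in> S" "?p - ?q = of_real t * (a - b)"
      using t S seg[of t x] seg[of t y] by (auto simp: a_def b_def right_diff_distrib)
    have "?p \<noteq> ?q" using nz t by auto
    then have "0 < t * Re (c * ((f' ?p - f' ?q) / (?p - ?q)))"
      using Re_difference_quotient_pos[OF \<open>convex S\<close> pq(1,2) _ f' pos] t by auto
    also have "\<dots> = Re (of_real t * (c * ((f' ?p - f' ?q) / (?p - ?q))))"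
      by (simp only: scaleR_conv_of_real[symmetric] scaleR_complex.sel)
    also have "of_real t * (c * ((f' ?p - f' ?q) / (?p - ?q))) = h' t"
      unfolding pq(3) h'_def using nz t by (simp add: field_simps)
    finally show "0 < Re (h' t)" .
  qed
  moreover have "h 0 = h 1"
    using eq by (simp add: h_def a_def b_def)
  ultimately show False by simp
qed

text \<open>
  The confluent case of the preceding argument, in which two of the three points merge into the
  critical point \<open>z\<close>.
\<close>
lemma critical_point_not_revisited:
  fixes f :: "complex \<Rightarrow> complex"
  assumes "convex S" and S: "z \<in> S" "x \<in> S" and "x \<noteq> z"
    and f: "\<And>z. z \<in> S \<Longrightarrow> (f has_field_derivative f' z) (at z)"
    and f': "\<And>z. z \<in> S \<Longrightarrow> (f' has_field_derivative f'' z) (at z)"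
    and pos: "\<And>z. z \<in> S \<Longrightarrow> Re (c * f'' z) > 0"
    and crit: "f' z = 0"
  shows "f x \<noteq> f z"
proof
  assume eq: "f x = f z"
  define a where "a = x - z"
  have nz: "a \<noteq> 0"
    using \<open>x \<noteq> z\<close> by (auto simp: a_def)
  have seg: "z + of_real t * a \<in> S" if "t \<in> {0..1}" for t
  proof -
    have "(1 - t) *\<^sub>R z + t *\<^sub>R x \<in> S"
      using assms that by (intro convexD) auto
    then show ?thesis by (simp add: a_def scaleR_conv_of_real algebra_simps)
  qed
  define h where "h t = c / a\<^sup>2 * f (z + of_real t * a)" for t
  define h' where "h' t = c / a\<^sup>2 * (a * f' (z + of_real t * a))" for t
  have "Re (h 0) < Re (h 1)"
  proof (rule Re_less_Re_if_deriv_pos[where h' = h'])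
    fix t :: real assume "t \<in> {0..1}"
    then show "(h has_vector_derivative h' t) (at t)"
      unfolding h_def h'_def
      by (intro has_vector_derivative_mult_right has_vector_derivative_along_segment f seg)
  next
    fix t :: real assume t: "t \<in> {0<..<1}"
    let ?p = "z + of_real t * a"
    have "0 < t * Re (c * ((f' ?p - f' z) / (?p - z)))"
      using Re_difference_quotient_pos[OF \<open>convex S\<close> seg S(1) _ f' pos] t nz by auto
    also have "\<dots> = Re (of_real t * (c * ((f' ?p - f' z) / (?p - z))))"
      by (simp only: scaleR_conv_of_real[symmetric] scaleR_complex.sel)
    also have "of_real t * (c * ((f' ?p - f' z) / (?p - z))) = h' t"
      unfolding h'_def using nz t by (simp add: crit field_simps power2_eq_square)
    finally show "0 < Re (h' t)" .
  qed
  moreover have "h 0 = h 1"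
    using eq by (simp add: h_def a_def)
  ultimately show False by simp
qed

section \<open>Multiplicities, degrees of conformal models, and rectangles\<close>

lemma multiplicity_at_if_second_deriv_nonzero:
  assumes holo: "f holomorphic_on S" and "open S" "z \<in> S"
    and nz: "deriv (deriv f) z \<noteq> 0"
  shows "multiplicity_at f z = (if deriv f z = 0 then 2 else 1)"
proof -
  have deriv_diff: "deriv (\<lambda>u. f u - f z) = deriv f"
  proof -
    have "((\<lambda>u. f u - f z) has_field_derivative d) (at x) \<longleftrightarrow> (f has_field_derivative d) (at x)"
      for x d
      using DERIV_add[of "\<lambda>u. f u - f z" d x UNIV "\<lambda>_. f z" 0] DERIV_diff[of f d x UNIV "\<lambda>_. f z" 0]
      by auto
    then show ?thesis by (simp add: deriv_def fun_eq_iff)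
  qed
  have nonconst: "\<not> (\<forall>\<^sub>F u in nhds z. f u = f z)"
  proof
    assume "\<forall>\<^sub>F u in nhds z. f u = f z"
    then have "(deriv ^^ 2) f z = (deriv ^^ 2) (\<lambda>_. f z) z"
      by (intro higher_deriv_cong_ev) auto
    with nz show False by (simp add: numeral_2_eq_2)
  qed
  have holo': "(\<lambda>u. f u - f z) holomorphic_on S"
    using holo by (intro holomorphic_intros)
  show ?thesis
  proof (cases "deriv f z = 0")
    case True
    have "zorder (\<lambda>u. f u - f z) z = 2"
    proof (rule zorder_zero_eqI[OF holo' \<open>open S\<close> \<open>z \<in> S\<close>])
      show "(deriv ^^ i) (\<lambda>u. f u - f z) z = 0" if "i < nat 2" for i
        using that True deriv_diff by (auto simp: less_Suc_eq numeral_2_eq_2)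
      show "(deriv ^^ nat 2) (\<lambda>u. f u - f z) z \<noteq> 0"
        using nz deriv_diff by (simp add: numeral_2_eq_2)
    qed simp
    with True nonconst show ?thesis
      by (simp add: multiplicity_at_def numeral_eq_enat)
  next
    case False
    have "zorder (\<lambda>u. f u - f z) z = 1"
      by (rule zorder_zero_eqI[OF holo' \<open>open S\<close> \<open>z \<in> S\<close>]) (use False deriv_diff in auto)
    with False nonconst show ?thesis
      by (simp add: multiplicity_at_def one_enat_def)
  qed
qed

text \<open>
  By the chain rule \<open>f' = (p' \<circ> \<phi>) * \<phi>'\<close>, where \<open>\<phi>'\<close> has no zero because \<open>\<phi>\<close> is injective. So \<open>\<phi>\<close>
  carries \<open>C\<close> into the zeros of \<open>p'\<close>, a nonzero polynomial as \<open>f\<close> is not constant.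
\<close>
lemma degree_gt_card_critical_points:
  assumes model: "conformal_model p f D" and "open D"
    and C: "C \<subseteq> D" "\<And>z. z \<in> C \<Longrightarrow> deriv f z = 0"
    and nonconst: "x \<in> D" "y \<in> D" "f x \<noteq> f y"
  shows "card C < degree p"
proof -
  obtain \<phi> where \<phi>: "\<phi> holomorphic_on D" "inj_on \<phi> D" "\<And>z. z \<in> D \<Longrightarrow> f z = poly p (\<phi> z)"
    using model unfolding conformal_model_def by blast
  have "degree p \<noteq> 0"
  proof
    assume "degree p = 0"
    then obtain a where "p = [:a:]" by (rule degree_eq_zeroE)
    then show False using nonconst \<phi>(3) by simp
  qed
  then have "pderiv p \<noteq> 0" by (simp add: pderiv_eq_0_iff)
  have "\<phi> ` C \<subseteq> {u. poly (pderiv p) u = 0}"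
  proof clarify
    fix z assume "z \<in> C"
    then have z: "z \<in> D" using C by blast
    have "(\<phi> has_field_derivative deriv \<phi> z) (at z)"
      using \<phi>(1) \<open>open D\<close> z by (rule holomorphic_derivI)
    then have "((\<lambda>u. poly p (\<phi> u)) has_field_derivative deriv \<phi> z * poly (pderiv p) (\<phi> z)) (at z)"
      by (auto intro!: derivative_eq_intros)
    moreover have "\<forall>\<^sub>F u in nhds z. f u = poly p (\<phi> u)"
      using \<phi>(3) \<open>open D\<close> z eventually_nhds by blast
    ultimately have "deriv f z = deriv \<phi> z * poly (pderiv p) (\<phi> z)"
      by (metis DERIV_imp_deriv deriv_cong_ev)
    moreover have "deriv \<phi> z \<noteq> 0"
      using holomorphic_injective_imp_regular[OF \<phi>(1) \<open>open D\<close> \<phi>(2) z] .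
    ultimately show "poly (pderiv p) (\<phi> z) = 0"
      using C(2)[OF \<open>z \<in> C\<close>] by simp
  qed
  moreover have "card (\<phi> ` C) = card C"
    using \<phi>(2) C(1) by (meson card_image inj_on_subset)
  moreover have "finite {u. poly (pderiv p) u = 0}"
    using \<open>pderiv p \<noteq> 0\<close> by (rule poly_roots_finite)
  ultimately have "card C \<le> card {u. poly (pderiv p) u = 0}"
    by (metis card_mono)
  also have "\<dots> \<le> degree (pderiv p)"
    using \<open>pderiv p \<noteq> 0\<close> by (rule card_poly_roots_bound)
  also have "\<dots> < degree p"
    using \<open>degree p \<noteq> 0\<close> by (simp add: degree_pderiv)
  finally show ?thesis .
qed

lemma jordan_domain_box:
  fixes a b :: complex
  assumes less: "Re a < Re b" "Im a < Im b"
  shows "jordan_domain (box a b)"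
proof -
  let ?J = "path_image (rectpath a b)"
  have J: "?J = cbox a b - box a b"
    using less by (intro path_image_rectpath_cbox_minus_box) auto
  have "jordan_curve ?J"
    unfolding jordan_curve_def using less
    by (intro exI[of _ "rectpath a b"]) auto
  moreover have "box a b \<in> components (- ?J)"
    unfolding in_components_maximal
  proof (intro conjI allI impI)
    show "box a b \<noteq> {}" using less by (auto simp: box_ne_empty Basis_complex_def)
    show "box a b \<subseteq> - ?J" using J by auto
    show "connected (box a b)" by (simp add: convex_connected)
    fix T assume T: "T \<noteq> {} \<and> box a b \<subseteq> T \<and> T \<subseteq> - ?J \<and> connected T"
    \<comment> \<open>A connected set that meets the box without being contained in it meets its frontier.\<close>
    have "frontier (box a b) \<subseteq> ?J"
      using J closure_minimal[OF box_subset_cbox[of a b] closed_cbox]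
      by (auto simp: frontier_def interior_open open_box)
    with T have "T \<inter> frontier (box a b) = {}" by blast
    then have "T \<inter> box a b = {} \<or> T - box a b = {}"
      using T connected_Int_frontier by blast
    with T \<open>box a b \<noteq> {}\<close> show "T = box a b" by blast
  qed
  ultimately show ?thesis unfolding jordan_domain_def using bounded_box by blast
qed

section \<open>The function \<open>z + exp z\<close>\<close>

lemma
  shows has_field_derivative_id_plus_exp:
      "((\<lambda>z. z + exp z) has_field_derivative 1 + exp z) (at (z::complex))"
    and has_field_derivative_one_plus_exp:
      "((\<lambda>z. 1 + exp z) has_field_derivative exp z) (at (z::complex))"
  by (auto intro!: derivative_eq_intros)

lemma deriv_id_plus_exp: "deriv (\<lambda>z::complex. z + exp z) = (\<lambda>z. 1 + exp z)"
  using has_field_derivative_id_plus_exp by (auto intro!: DERIV_imp_deriv)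

lemma multiplicity_at_id_plus_exp:
  "multiplicity_at (\<lambda>z. z + exp z) z = (if 1 + exp z = 0 then 2 else 1)"
proof -
  have "deriv (deriv (\<lambda>z. z + exp z)) z = exp z"
    unfolding deriv_id_plus_exp using has_field_derivative_one_plus_exp by (rule DERIV_imp_deriv)
  then show ?thesis
    by (subst multiplicity_at_if_second_deriv_nonzero[of _ UNIV])
      (auto simp: deriv_id_plus_exp intro!: holomorphic_intros)
qed

text \<open>
  The constant 3 matters only in being less than \<open>pi\<close>, and \<open>ln (3/2)\<close> is chosen so that
  \<open>exp x\<close> and \<open>exp y\<close> contribute at most half of it each.
\<close>
lemma Im_close_if_id_plus_exp_eq:
  fixes x y :: complex
  assumes eq: "x + exp x = y + exp y" and Re: "Re x < ln (3/2)" "Re y < ln (3/2)"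
  shows "\<bar>Im x - Im y\<bar> < 3"
proof -
  have "norm (exp u) < 3/2" if "Re u < ln (3/2)" for u :: complex
    using exp_less_mono[OF that] by simp
  then have "norm (exp y) + norm (exp x) < 3"
    using Re by (smt (verit) field_sum_of_halves)
  then have "norm (exp y - exp x) < 3"
    using norm_triangle_ineq4 by (rule le_less_trans[rotated])
  moreover have "x - y = exp y - exp x"
    using eq by (simp add: algebra_simps)
  ultimately show ?thesis
    using abs_Im_le_cmod[of "x - y"] by (metis le_less_trans minus_complex.sel(2))
qed

definition strip :: "real \<Rightarrow> complex set" where
  "strip m = {z. m - pi / 2 < Im z \<and> Im z < m + pi / 2}"

lemma convex_strip: "convex (strip m)"
proof -
  have "strip m = {z. Im z < m + pi / 2} \<inter> {z. Im z > m - pi / 2}"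
    by (auto simp: strip_def)
  then show ?thesis
    by (simp add: convex_Int convex_halfspace_Im_lt convex_halfspace_Im_gt)
qed

text \<open>
  On the strip the argument of \<open>exp z\<close> differs from \<open>m\<close> by less than a right angle.
\<close>
lemma Re_rotated_exp_pos:
  assumes "z \<in> strip m"
  shows "Re (cis (- m) * exp z) > 0"
proof -
  have "cis (- m) * exp z = exp (z - \<i> * of_real m)"
    by (simp add: cis_conv_exp exp_diff exp_minus field_simps)
  then have "Re (cis (- m) * exp z) = exp (Re z) * cos (Im z - m)"
    by (simp add: Re_exp)
  moreover have "cos (Im z - m) > 0"
    using assms by (intro cos_gt_zero_pi) (auto simp: strip_def)
  ultimately show ?thesis by simp
qed

lemma three_points_in_strip:
  assumes "\<bar>Im x - Im y\<bar> < 3" "\<bar>Im x - Im z\<bar> < 3" "\<bar>Im y - Im z\<bar> < 3"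
  obtains m where "x \<in> strip m" "y \<in> strip m" "z \<in> strip m"
proof
  define lo hi where "lo = Min {Im x, Im y, Im z}" and "hi = Max {Im x, Im y, Im z}"
  have "lo \<le> Im x" "lo \<le> Im y" "lo \<le> Im z" "Im x \<le> hi" "Im y \<le> hi" "Im z \<le> hi"
    by (auto simp: lo_def hi_def)
  moreover have "hi - lo < pi"
  proof -
    have "lo \<in> {Im x, Im y, Im z}" "hi \<in> {Im x, Im y, Im z}"
      unfolding lo_def hi_def by (intro Min_in Max_in; simp)+
    then have "hi - lo < 3" using assms by auto
    then show ?thesis using pi_gt3 by linarith
  qed
  ultimately show "x \<in> strip ((lo + hi) / 2)" "y \<in> strip ((lo + hi) / 2)"
      "z \<in> strip ((lo + hi) / 2)"
    by (auto simp: strip_def field_simps)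
qed

text \<open>
  Counted with multiplicity, there are three ways to exceed two: three distinct preimages, two
  preimages of which one is critical, and one preimage of multiplicity three. The last is
  impossible because \<open>exp\<close>, the second derivative, has no zeros; the other two are excluded in a
  strip that contains the preimages concerned.
\<close>
lemma preimage_count_id_plus_exp_le_2:
  assumes D: "\<And>z. z \<in> D \<Longrightarrow> Re z < ln (3/2)"
  shows "preimage_count (\<lambda>z. z + exp z) D w \<le> 2"
proof -
  let ?f = "\<lambda>z::complex. z + exp z"
  define A where "A = {z \<in> D. ?f z = w}"
  have close: "\<bar>Im x - Im y\<bar> < 3" if "x \<in> A" "y \<in> A" for x y
    using that D by (intro Im_close_if_id_plus_exp_eq) (auto simp: A_def)
  have no3: "x = z \<or> y = z \<or> x = y" if xyz: "x \<in> A" "y \<in> A" "z \<in> A" for x y z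
  proof (rule ccontr)
    assume neq: "\<not> ?thesis"
    obtain m where "x \<in> strip m" "y \<in> strip m" "z \<in> strip m"
      using three_points_in_strip[of x y z] close xyz by metis
    then have "\<not> (?f x = ?f z \<and> ?f y = ?f z)"
      using neq
      by (intro no_three_equal_values[OF convex_strip _ _ _ _ _ _
            has_field_derivative_id_plus_exp has_field_derivative_one_plus_exp Re_rotated_exp_pos])
        auto
    then show False using xyz by (simp add: A_def)
  qed
  have regular: "multiplicity_at ?f z = 1" if xz: "x \<in> A" "z \<in> A" "x \<noteq> z" for x z
  proof -
    obtain m where m: "x \<in> strip m" "z \<in> strip m"
      using three_points_in_strip[of x x z] close xz by metis
    have "?f x = ?f z" using xz by (simp add: A_def)
    then have "1 + exp z \<noteq> 0"
      using critical_point_not_revisited[OF convex_strip m(2,1) xz(3)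
            has_field_derivative_id_plus_exp has_field_derivative_one_plus_exp Re_rotated_exp_pos]
      by blast
    then show ?thesis by (simp add: multiplicity_at_id_plus_exp)
  qed
  have "finite A \<and> (\<Sum>z\<in>A. multiplicity_at ?f z) \<le> 2"
  proof (cases "\<exists>x\<in>A. \<exists>y\<in>A. x \<noteq> y")
    case True
    then obtain x y where xy: "x \<in> A" "y \<in> A" "x \<noteq> y" by blast
    then have "A = {x, y}" using no3 by blast
    moreover have "multiplicity_at ?f x = 1" "multiplicity_at ?f y = 1"
      using regular xy by metis+
    ultimately show ?thesis using xy(3) by simp
  next
    case False
    then consider "A = {}" | z where "A = {z}" by blast
    then show ?thesis
      by cases (auto simp: multiplicity_at_id_plus_exp)
  qed
  then show ?thesis
    unfolding preimage_count_def A_def by simp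
qed

lemma preimage_count_ge_multiplicity:
  assumes "z \<in> E"
  shows "multiplicity_at f z \<le> preimage_count f E (f z)"
  using assms unfolding preimage_count_def by (auto intro!: member_le_sum)

theorem mainTheorem2:
  fixes n :: nat
  assumes "n \<ge> 4"
  shows "\<exists>(D :: complex set) (f :: complex \<Rightarrow> complex).
           jordan_domain D \<and>
           (\<exists>U. open U \<and> closure D \<subseteq> U \<and> f analytic_on U) \<and>
           noninjectivity_degree f D = 2 \<and>
           (\<forall>p. conformal_model p f D \<longrightarrow> degree p \<ge> n)"
proof -
  let ?f = "\<lambda>z::complex. z + exp z"
  define D where "D = box (Complex (- 1) 0) (Complex (ln (3/2)) (2 * pi * real n))"
  have D_iff: "z \<in> D \<longleftrightarrow> - 1 < Re z \<and> Re z < ln (3/2) \<and> 0 < Im z \<and> Im z < 2 * pi * real n"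
    for z
    by (auto simp: D_def in_box_complex_iff)
  have less_ln: "- 1 < ln (3/2 :: real)" by (rule less_trans[of _ 0]) simp_all
  define crit where "crit k = Complex 0 (pi * (2 * real k + 1))" for k :: nat
  have exp_crit: "exp (crit k) = - 1" for k
  proof -
    have "crit k = Complex 0 (pi * real (2 * k + 1))"
      by (simp add: crit_def algebra_simps)
    then show ?thesis
      by (simp only: complex_eq_iff Re_exp Im_exp complex.sel cos_npi2 sin_npi2) simp
  qed
  have crit_in_D: "crit k \<in> D" if "k < n" for k
  proof -
    have "2 * real k + 1 < 2 * real n" using that by linarith
    then have "pi * (2 * real k + 1) < pi * (2 * real n)" by simp
    then show ?thesis
      unfolding D_iff crit_def by (simp add: mult.commute mult.left_commute)
  qed
  have inj: "inj crit" by (auto simp: inj_on_def crit_def)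
  have "jordan_domain D"
    unfolding D_def using less_ln assms by (intro jordan_domain_box) auto
  moreover have "?f analytic_on UNIV" by (intro analytic_intros)
  moreover have "noninjectivity_degree ?f D = 2"
  proof (rule antisym)
    show "noninjectivity_degree ?f D \<le> 2"
      unfolding noninjectivity_degree_def
      by (intro SUP_least preimage_count_id_plus_exp_le_2) (simp add: D_iff)
    have "2 = multiplicity_at ?f (crit 0)"
      by (simp add: multiplicity_at_id_plus_exp exp_crit)
    also have "\<dots> \<le> preimage_count ?f D (?f (crit 0))"
      using assms by (intro preimage_count_ge_multiplicity crit_in_D) simp
    also have "\<dots> \<le> noninjectivity_degree ?f D"
      unfolding noninjectivity_degree_def by (intro SUP_upper) simp
    finally show "2 \<le> noninjectivity_degree ?f D" .
  qed
  moreover have "degree p \<ge> n" if "conformal_model p ?f D" for p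
  proof -
    have "card (crit ` {..<n}) < degree p"
    proof (rule degree_gt_card_critical_points[OF that])
      show "open D" by (simp add: D_def open_box)
      show "crit ` {..<n} \<subseteq> D" using crit_in_D by auto
      show "deriv ?f z = 0" if "z \<in> crit ` {..<n}" for z
        using that by (auto simp: deriv_id_plus_exp exp_crit)
      show "crit 0 \<in> D" "crit 1 \<in> D" using assms by (auto intro: crit_in_D)
      show "?f (crit 0) \<noteq> ?f (crit 1)"
        using inj by (simp add: exp_crit inj_eq)
    qed
    moreover have "card (crit ` {..<n}) = n"
      using inj by (simp add: card_image inj_on_subset)
    ultimately show ?thesis by simp
  qed
  ultimately show ?thesis by blast
qed

end
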